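(* Every $\mathcal{L}_\infty$-space not containing $c_0$ (i.e. having no subspace isomorphic to $c_0$) is an $\mathscr{LP}$ space.
   Context: A Banach space $E$ is an $\mathcal{L}_\infty$-space if there is $\mu\ge 1$ such that every finite-dimensional subspace of $E$ is contained in a finite-dimensional subspace $G$ with Banach–Mazur distance to $\ell_\infty^{\dim G}$ at most $\mu$. A Banach space $E$ is an $\mathscr{LP}$ (Lindenstrauss–Pełczyński) space if every bounded linear operator from a closed subspace of $c_0$ into $E$ can be extended to a bounded linear operator $c_0\to E$. *)

theory Defs
  imports "HOL-Analysis.Analysis"
begin

text \<open>
  Banach spaces are real. The space of bounded real sequences with the supremum norm is the
  library type \<open>(nat, real) bcontfun\<close> (every sequence is continuous, as \<open>nat\<close> is discrete);
  \<open>c\<^sub>0\<close> and the finite-dimensional spaces of type \<open>\<ell>\<^sub>\<infinity>\<close> are taken as subspaces of it.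
\<close>

type_synonym linf = "(nat, real) bcontfun"

definition c0 :: "linf set" where
  "c0 = {x. apply_bcontfun x \<longlonglongrightarrow> 0}"

definition linf_dim :: "nat \<Rightarrow> linf set" where
  "linf_dim n = {x. \<forall>i\<ge>n. apply_bcontfun x i = 0}"

lemma linf_norm_le_iff: "norm (x :: linf) \<le> b \<longleftrightarrow> (\<forall>i. \<bar>apply_bcontfun x i\<bar> \<le> b)"
  by (metis norm_bound norm_bounded order_trans real_norm_def)

lemma subspace_c0: "subspace c0"
  by (auto simp: subspace_def c0_def plus_bcontfun.rep_eq scaleR_bcontfun.rep_eq
      zero_bcontfun.rep_eq intro: tendsto_add_zero tendsto_mult_right_zero)

lemma closed_c0: "closed c0"
  unfolding closed_sequential_limits
proof (intro allI impI, elim conjE)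
  fix f :: "nat \<Rightarrow> linf" and l
  assume f: "\<forall>n. f n \<in> c0" and l: "f \<longlonglongrightarrow> l"
  have "\<forall>\<^sub>F i in sequentially. \<bar>apply_bcontfun l i\<bar> < e" if "e > 0" for e
  proof -
    have "\<forall>\<^sub>F n in sequentially. dist (f n) l < e / 2"
      using l that by (intro tendstoD) auto
    then obtain n where n: "dist (f n) l < e / 2"
      by (auto simp: eventually_sequentially)
    have "\<forall>\<^sub>F i in sequentially. dist (apply_bcontfun (f n) i) 0 < e / 2"
      using f that by (intro tendstoD) (auto simp: c0_def)
    then show ?thesis
    proof eventually_elim
      case (elim i)
      have "dist (apply_bcontfun (f n) i) (apply_bcontfun l i) \<le> dist (f n) l"
        by (rule dist_bounded)
      with elim n show ?case by (simp add: dist_real_def)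
    qed
  qed
  then show "l \<in> c0" by (simp add: c0_def tendsto_iff dist_real_def)
qed

lemma subspace_linf_dim: "subspace (linf_dim n)"
  by (auto simp: subspace_def linf_dim_def plus_bcontfun.rep_eq scaleR_bcontfun.rep_eq
      zero_bcontfun.rep_eq)

text \<open>
  Operators between linear subspaces are functions on the ambient types of which only the values
  on the domain subspace matter.
\<close>

definition bounded_linear_on ::
    "'a::real_normed_vector set \<Rightarrow> ('a \<Rightarrow> 'b::real_normed_vector) \<Rightarrow> bool" where
  "bounded_linear_on X T \<longleftrightarrow>
     (\<forall>x\<in>X. \<forall>y\<in>X. T (x + y) = T x + T y) \<and>
     (\<forall>r. \<forall>x\<in>X. T (r *\<^sub>R x) = r *\<^sub>R T x) \<and>
     (\<exists>K. \<forall>x\<in>X. norm (T x) \<le> norm x * K)"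

lemma bounded_linear_on_UNIV: "bounded_linear_on UNIV T \<longleftrightarrow> bounded_linear T"
  by (auto simp: bounded_linear_on_def bounded_linear_def bounded_linear_axioms_def linear_iff)

definition onorm_on ::
    "'a::real_normed_vector set \<Rightarrow> ('a \<Rightarrow> 'b::real_normed_vector) \<Rightarrow> real" where
  "onorm_on X T = (SUP x\<in>X. norm (T x) / norm x)"

definition isomorphism_on ::
    "'a::real_normed_vector set \<Rightarrow> 'b::real_normed_vector set \<Rightarrow> ('a \<Rightarrow> 'b) \<Rightarrow> bool" where
  "isomorphism_on X Y T \<longleftrightarrow>
     bij_betw T X Y \<and> bounded_linear_on X T \<and> bounded_linear_on Y (inv_into X T)"

definition isomorphic_spaces ::
    "'a::real_normed_vector set \<Rightarrow> 'b::real_normed_vector set \<Rightarrow> bool" where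
  "isomorphic_spaces X Y \<longleftrightarrow> (\<exists>T. isomorphism_on X Y T)"

text \<open>The distance of non-isomorphic spaces is \<open>\<infinity>\<close>.\<close>

definition banach_mazur ::
    "'a::real_normed_vector set \<Rightarrow> 'b::real_normed_vector set \<Rightarrow> ereal" where
  "banach_mazur X Y =
     (INF T\<in>{T. isomorphism_on X Y T}. ereal (onorm_on X T * onorm_on Y (inv_into X T)))"

text \<open>
  The library has no predicate for finite-dimensionality of a subspace, and \<open>dim\<close> is only
  meaningful in its presence.
\<close>

definition fin_dim_subspace :: "'a::real_vector set \<Rightarrow> bool" where
  "fin_dim_subspace F \<longleftrightarrow> (\<exists>B. finite B \<and> F = span B)"

definition L_infinity_space :: "'a::banach itself \<Rightarrow> bool" where
  "L_infinity_space _ \<longleftrightarrow>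
     (\<exists>\<mu>\<ge>1. \<forall>F::'a set. fin_dim_subspace F \<longrightarrow>
        (\<exists>G. fin_dim_subspace G \<and> F \<subseteq> G \<and> banach_mazur G (linf_dim (dim G)) \<le> ereal \<mu>))"

definition contains_c0 :: "'a::banach itself \<Rightarrow> bool" where
  "contains_c0 _ \<longleftrightarrow> (\<exists>F::'a set. subspace F \<and> isomorphic_spaces c0 F)"

definition LP_space :: "'a::banach itself \<Rightarrow> bool" where
  "LP_space _ \<longleftrightarrow>
     (\<forall>Y (t :: linf \<Rightarrow> 'a). Y \<subseteq> c0 \<and> subspace Y \<and> closed Y \<and> bounded_linear_on Y t \<longrightarrow>
        (\<exists>T. bounded_linear_on c0 T \<and> (\<forall>y\<in>Y. T y = t y)))"

end

theory Submission
  imports Defs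
begin

text \<open>
  Let \<open>E\<close> be an \<open>\<L>\<^sub>\<infinity>\<close>-space without a copy of \<open>c\<^sub>0\<close>, and let \<open>t\<close> be a bounded operator from a
  subspace \<open>Y\<close> of \<open>c\<^sub>0\<close> into \<open>E\<close>. The proof shows that \<open>t\<close> is compact and that compact operators
  into \<open>E\<close> extend.

  Compactness (\<open>totally_bounded_image_if_no_c0\<close>). If \<open>t\<close> is not small on those bounded vectors of
  \<open>Y\<close> whose first coordinates are small, then a gliding hump yields vectors \<open>u\<^sub>k\<close> of \<open>Y\<close> that
  are almost disjointly supported while \<open>t u\<^sub>k\<close> stays away from \<open>0\<close>. The sums of the \<open>t u\<^sub>k\<close> with
  coefficients in \<open>[-1, 1]\<close> are then uniformly bounded. Take norming functionals \<open>f\<^sub>k\<close> of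
  \<open>t u\<^sub>k\<close>: the rows of the matrix \<open>f\<^sub>k (t u\<^sub>j)\<close> have bounded \<open>\<ell>\<^sub>1\<close>-norm, so Rosenthal's lemma
  makes the off-diagonal part of each row small along a subsequence, and the diagonal entries then
  bound the operator \<open>a \<mapsto> \<Sum> a\<^sub>k t u\<^sub>k\<close> from below. Hence \<open>E\<close> contains \<open>c\<^sub>0\<close>
  (\<open>contains_c0_if_unconditionally_bounded\<close>), a contradiction. Otherwise finitely many coordinates,
  known up to a finite precision, determine \<open>t y\<close> up to \<open>\<epsilon>\<close> on the unit ball, and so the image of
  the ball has a finite \<open>\<epsilon>\<close>-net.

  Extension. A space that is \<open>C\<close>-isomorphic to \<open>\<ell>\<^sub>\<infinity>\<^sup>n\<close> is \<open>C\<close>-injective, by applying the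
  Hahn-Banach theorem to each coordinate (\<open>extension_into_near_linf_dim\<close>). Such spaces are cofinal
  among the finite-dimensional subspaces of \<open>E\<close>, with one constant \<open>C\<close>. A projection of norm at
  most \<open>C\<close> onto one that contains an \<open>\<epsilon>\<close>-net turns \<open>t\<close> into a finite-rank operator within
  \<open>(1 + C) \<epsilon>\<close> of \<open>t\<close>. So \<open>t\<close> is the sum of a series of finite-rank operators with geometrically
  decreasing norms; each of them extends at the cost of the factor \<open>C\<close>, and the sum of the
  extensions extends \<open>t\<close> (\<open>extension_of_uniform_limit_of_finite_rank\<close>).
\<close>

section \<open>The Hahn-Banach theorem\<close>

definition sublinear :: "('a::real_vector \<Rightarrow> real) \<Rightarrow> bool" where
  "sublinear p \<longleftrightarrow>
     (\<forall>x y. p (x + y) \<le> p x + p y) \<and> (\<forall>c x. 0 \<le> c \<longrightarrow> p (c *\<^sub>R x) = c * p x)"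

lemma sublinear_zero: "sublinear p \<Longrightarrow> p 0 = 0"
  unfolding sublinear_def by (metis mult_zero_left order_refl scaleR_zero_left)

lemma sublinear_lower:
  assumes "sublinear p"
  shows "- p (- x) \<le> p x"
proof -
  have "p (x + - x) \<le> p x + p (- x)" using assms unfolding sublinear_def by blast
  then show ?thesis using sublinear_zero[OF assms] by simp
qed

text \<open>
  The function \<open>x \<mapsto> inf\<^sub>y (q (x - y) + f y)\<close> is the largest sublinear function that lies below
  \<open>q\<close> everywhere and below \<open>f\<close> on the cone \<open>C\<close>; the lower bound on \<open>f\<close> keeps it finite.
  It serves twice in the proof of the Hahn-Banach theorem: with a ray as \<open>C\<close> it shows that minimal
  sublinear functions are linear, and with a subspace as \<open>C\<close> it encodes the functional that is to
  be extended.
\<close>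

lemma sublinear_inf_cone:
  fixes q f :: "'a::real_vector \<Rightarrow> real"
  assumes q: "sublinear q"
    and C0: "0 \<in> C" and Cadd: "\<And>y z. y \<in> C \<Longrightarrow> z \<in> C \<Longrightarrow> y + z \<in> C"
    and Cscale: "\<And>c y. 0 \<le> c \<Longrightarrow> y \<in> C \<Longrightarrow> c *\<^sub>R y \<in> C"
    and fadd: "\<And>y z. y \<in> C \<Longrightarrow> z \<in> C \<Longrightarrow> f (y + z) \<le> f y + f z"
    and fscale: "\<And>c y. 0 \<le> c \<Longrightarrow> y \<in> C \<Longrightarrow> f (c *\<^sub>R y) = c * f y"
    and flower: "\<And>y. y \<in> C \<Longrightarrow> - q (- y) \<le> f y"
  obtains r where "sublinear r" and "\<And>x y. y \<in> C \<Longrightarrow> r x \<le> q (x - y) + f y"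
proof
  define r where "r = (\<lambda>x. INF y\<in>C. q (x - y) + f y)"
  have qadd: "q (x + y) \<le> q x + q y" and qscale: "0 \<le> c \<Longrightarrow> q (c *\<^sub>R x) = c * q x" for x y c
    using q by (auto simp: sublinear_def)
  have lower: "- q (- x) \<le> q (x - y) + f y" if "y \<in> C" for x y
    using qadd[of "x - y" "- x"] flower[OF that] by simp
  have upper: "r x \<le> q (x - y) + f y" if "y \<in> C" for x y
    unfolding r_def using that lower by (intro cINF_lower bdd_belowI2) auto
  have greatest: "m \<le> r x" if "\<And>y. y \<in> C \<Longrightarrow> m \<le> q (x - y) + f y" for m x
    unfolding r_def using C0 that by (intro cINF_greatest) auto
  show "\<And>x y. y \<in> C \<Longrightarrow> r x \<le> q (x - y) + f y" by (rule upper)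
  have radd: "r (x + x') \<le> r x + r x'" for x x'
  proof -
    have "r (x + x') \<le> (q (x - y) + f y) + (q (x' - z) + f z)" if "y \<in> C" "z \<in> C" for y z
    proof -
      have "r (x + x') \<le> q ((x + x') - (y + z)) + f (y + z)"
        using that by (intro upper Cadd)
      also have "(x + x') - (y + z) = (x - y) + (x' - z)" by simp
      finally show ?thesis using qadd[of "x - y" "x' - z"] fadd[OF that] by linarith
    qed
    then have "r (x + x') - (q (x - y) + f y) \<le> r x'" if "y \<in> C" for y
      using that by (intro greatest) (smt (verit))
    then have "r (x + x') - r x' \<le> r x"
      by (intro greatest) (smt (verit))
    then show ?thesis by simp
  qed
  have f0: "f 0 = 0" using fscale[of 0 0] C0 by simp
  have q0: "q 0 = 0" using q by (rule sublinear_zero)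
  have r0: "r 0 = 0"
    using upper[of 0 0] greatest[of 0 0] lower[of _ 0] C0 f0 q0 by fastforce
  have rle: "r (c *\<^sub>R x) \<le> c * r x" if "0 < c" for c x
  proof -
    have "r (c *\<^sub>R x) / c \<le> q (x - y) + f y" if "y \<in> C" for y
    proof -
      have "r (c *\<^sub>R x) \<le> q (c *\<^sub>R x - c *\<^sub>R y) + f (c *\<^sub>R y)"
        using that \<open>0 < c\<close> by (intro upper Cscale) auto
      also have "\<dots> = c * (q (x - y) + f y)"
        using qscale[of c "x - y"] fscale[of c y] that \<open>0 < c\<close> by (simp add: algebra_simps)
      finally show ?thesis using \<open>0 < c\<close> by (simp add: field_simps)
    qed
    then have "r (c *\<^sub>R x) / c \<le> r x" by (rule greatest)
    then show ?thesis using that by (simp add: field_simps)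
  qed
  have "r (c *\<^sub>R x) = c * r x" if "0 \<le> c" for c x
  proof (cases "c = 0")
    case False
    then have "r ((1 / c) *\<^sub>R (c *\<^sub>R x)) \<le> (1 / c) * r (c *\<^sub>R x)"
      using that by (intro rle) auto
    then have "c * r x \<le> r (c *\<^sub>R x)" using False that by (simp add: field_simps)
    with rle[of c x] False that show ?thesis by auto
  qed (simp add: r0)
  with radd show "sublinear r" by (simp add: sublinear_def)
qed

text \<open>
  Zorn's lemma applies because the infimum of a chain of sublinear functions below \<open>p\<close> is
  sublinear: every \<open>q\<close> of the chain satisfies \<open>q x \<ge> - p (- x)\<close>, which keeps the infimum finite,
  and of two members of the chain the smaller one witnesses subadditivity.
\<close>

lemma minimal_sublinear_exists:
  fixes p :: "'a::real_vector \<Rightarrow> real"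
  assumes "sublinear p"
  obtains q where "sublinear q" "q \<le> p" "\<And>r. sublinear r \<Longrightarrow> r \<le> q \<Longrightarrow> r = q"
proof -
  define A where "A = {q. sublinear q \<and> q \<le> p}"
  have "\<exists>m\<in>A. \<forall>a\<in>A. m \<ge> a \<longrightarrow> a = m"
  proof (rule predicate_Zorn)
    show "partial_order_on A (relation_of (\<lambda>m a. m \<ge> a) A)"
      by (auto intro!: partial_order_on_relation_ofI)
    fix C assume C: "C \<in> Chains (relation_of (\<lambda>m a. m \<ge> a) A)"
    then have CA: "C \<subseteq> A" and tot: "\<And>q q'. q \<in> C \<Longrightarrow> q' \<in> C \<Longrightarrow> q \<le> q' \<or> q' \<le> q"
      by (auto simp: Chains_def relation_of_def)
    show "\<exists>u\<in>A. \<forall>a\<in>C. a \<ge> u"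
    proof (cases "C = {}")
      case True
      then show ?thesis using assms by (auto simp: A_def)
    next
      case False
      define r where "r = (\<lambda>x. INF q\<in>C. q x)"
      have lower: "- p (- x) \<le> q x" if "q \<in> C" for q x
      proof -
        have "sublinear q" "q (- x) \<le> p (- x)" using that CA by (auto simp: A_def le_fun_def)
        then show ?thesis using sublinear_lower[of q x] by linarith
      qed
      have upper: "r x \<le> q x" if "q \<in> C" for q x
        unfolding r_def using that lower by (intro cINF_lower bdd_belowI2) auto
      have greatest: "m \<le> r x" if "\<And>q. q \<in> C \<Longrightarrow> m \<le> q x" for m x
        unfolding r_def using False that by (intro cINF_greatest) auto
      have qadd: "q (x + y) \<le> q x + q y" and qscale: "0 \<le> c \<Longrightarrow> q (c *\<^sub>R x) = c * q x"
        if "q \<in> C" for q x y c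
        using that CA by (auto simp: A_def sublinear_def)
      have radd: "r (x + y) \<le> r x + r y" for x y
      proof -
        have "r (x + y) \<le> q x + q' y" if "q \<in> C" "q' \<in> C" for q q'
          using tot[OF that]
        proof
          assume "q \<le> q'"
          then show ?thesis
            using upper[OF that(1), of "x + y"] qadd[OF that(1), of x y] le_funD[of q q' y] by linarith
        next
          assume "q' \<le> q"
          then show ?thesis
            using upper[OF that(2), of "x + y"] qadd[OF that(2), of x y] le_funD[of q' q x] by linarith
        qed
        then have "r (x + y) - q x \<le> r y" if "q \<in> C" for q
          using that by (intro greatest) (smt (verit))
        then have "r (x + y) - r y \<le> r x"
          by (intro greatest) (smt (verit))
        then show ?thesis by simp
      qed
      have rscale: "r (c *\<^sub>R x) = c * r x" if "0 \<le> c" for c x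
      proof (cases "c = 0")
        case True
        have "q 0 = 0" if "q \<in> C" for q using qscale[OF that, of 0 0] by simp
        then have "(\<lambda>q. q 0) ` C = {0}" using False by force
        then show ?thesis using True by (simp add: r_def)
      next
        case c: False
        show ?thesis
        proof (rule antisym)
          have "r (c *\<^sub>R x) / c \<le> q x" if "q \<in> C" for q
            using upper[OF that, of "c *\<^sub>R x"] qscale[OF that, of c x] c \<open>0 \<le> c\<close>
            by (simp add: field_simps)
          then have "r (c *\<^sub>R x) / c \<le> r x" by (rule greatest)
          then show "r (c *\<^sub>R x) \<le> c * r x" using c that by (simp add: field_simps)
          show "c * r x \<le> r (c *\<^sub>R x)"
            using that by (intro greatest) (simp add: qscale mult_left_mono upper)
        qed
      qed
      obtain q where "q \<in> C" using False by blast
      then have "r x \<le> p x" for x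
        using upper[of q x] CA by (auto simp: A_def dest!: subsetD le_funD[of q p x])
      then have "r \<in> A" using radd rscale by (simp add: A_def sublinear_def le_fun_def)
      moreover have "\<forall>q\<in>C. r \<le> q" using upper by (simp add: le_fun_def)
      ultimately show ?thesis by blast
    qed
  qed
  then obtain m where m: "m \<in> A" "\<forall>a\<in>A. a \<le> m \<longrightarrow> a = m" by auto
  show ?thesis
    using m by (intro that[of m]) (auto simp: A_def)
qed

text \<open>
  Along the ray spanned by \<open>- v\<close> the function \<open>z \<mapsto> - q (- z)\<close> is additive, so lowering \<open>q\<close> to it
  on this ray gives a sublinear function below \<open>q\<close>. Minimality says that nothing changed, which
  is \<open>q x \<le> q (x + v) - q v\<close>.
\<close>

lemma minimal_sublinear_linear:
  fixes q :: "'a::real_vector \<Rightarrow> real"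
  assumes q: "sublinear q" and minimal: "\<And>r. sublinear r \<Longrightarrow> r \<le> q \<Longrightarrow> r = q"
  shows "linear q"
proof -
  have q0: "q 0 = 0" using q by (rule sublinear_zero)
  have qadd: "q (x + y) \<le> q x + q y" and qscale: "0 \<le> c \<Longrightarrow> q (c *\<^sub>R x) = c * q x" for x y c
    using q by (auto simp: sublinear_def)
  have sup: "q x + q v \<le> q (x + v)" for x v
  proof -
    define C where "C = (\<lambda>t. - (t *\<^sub>R v)) ` {0..}"
    have CI: "- (t *\<^sub>R v) \<in> C" if "0 \<le> t" for t using that by (auto simp: C_def)
    obtain r where r: "sublinear r" "\<And>x y. y \<in> C \<Longrightarrow> r x \<le> q (x - y) + - q (- y)"
    proof (rule sublinear_inf_cone[OF q, of C "\<lambda>z. - q (- z)"])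
      show "0 \<in> C" using CI[of 0] by simp
      show "y + z \<in> C" if "y \<in> C" "z \<in> C" for y z
      proof -
        obtain s t where "0 \<le> s" "y = - (s *\<^sub>R v)" "0 \<le> t" "z = - (t *\<^sub>R v)"
          using \<open>y \<in> C\<close> \<open>z \<in> C\<close> by (auto simp: C_def)
        then show ?thesis using CI[of "s + t"] by (simp add: scaleR_add_left)
      qed
      show "c *\<^sub>R y \<in> C" if "0 \<le> c" "y \<in> C" for c y
      proof -
        obtain s where "0 \<le> s" "y = - (s *\<^sub>R v)"
          using \<open>y \<in> C\<close> by (auto simp: C_def)
        then show ?thesis using CI[of "c * s"] \<open>0 \<le> c\<close> by simp
      qed
      show "- q (- (y + z)) \<le> - q (- y) + - q (- z)" if "y \<in> C" "z \<in> C" for y z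
      proof -
        obtain s t where "0 \<le> s" "y = - (s *\<^sub>R v)" "0 \<le> t" "z = - (t *\<^sub>R v)"
          using \<open>y \<in> C\<close> \<open>z \<in> C\<close> by (auto simp: C_def)
        then show ?thesis
          using qscale[of "s + t" v]
          by (simp add: qscale scaleR_add_left distrib_right add.commute)
      qed
      show "- q (- (c *\<^sub>R y)) = c * - q (- y)" if "0 \<le> c" "y \<in> C" for c y
        using qscale[OF that(1), of "- y"] by simp
    qed auto
    have "r \<le> q" using r(2)[of 0] CI[of 0] by (auto simp: le_fun_def q0)
    then have "r = q" using r(1) by (rule minimal[rotated])
    then have "q x \<le> q (x - (- (1 *\<^sub>R v))) + - q (- (- (1 *\<^sub>R v)))"
      using r(2)[OF CI[of 1], of x] by simp
    then show ?thesis by simp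
  qed
  have add: "q (x + y) = q x + q y" for x y using sup[of x y] qadd[of x y] by simp
  have neg: "q (- x) = - q x" for x using add[of x "- x"] q0 by simp
  show ?thesis
  proof (rule linearI)
    fix r x
    show "q (r *\<^sub>R x) = r *\<^sub>R q x"
      using qscale[of r x] qscale[of "- r" x] neg[of "r *\<^sub>R x"] by (cases "0 \<le> r") auto
  qed (rule add)
qed

text \<open>
  A minimal sublinear function below \<open>x \<mapsto> inf\<^sub>y (K \<parallel>x - y\<parallel> + f y)\<close> is linear and at most \<open>f\<close> on
  \<open>Y\<close>; as \<open>Y\<close> is symmetric, it equals \<open>f\<close> there.
\<close>

lemma hahn_banach_norm:
  fixes f :: "'a::real_normed_vector \<Rightarrow> real"
  assumes Y: "subspace Y"
    and fadd: "\<And>y z. y \<in> Y \<Longrightarrow> z \<in> Y \<Longrightarrow> f (y + z) = f y + f z"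
    and fscale: "\<And>c y. y \<in> Y \<Longrightarrow> f (c *\<^sub>R y) = c * f y"
    and fbound: "\<And>y. y \<in> Y \<Longrightarrow> \<bar>f y\<bar> \<le> K * norm y"
    and K: "0 \<le> K"
  obtains g where "linear g" "\<And>y. y \<in> Y \<Longrightarrow> g y = f y" "\<And>x. \<bar>g x\<bar> \<le> K * norm x"
proof -
  define p where "p = (\<lambda>x::'a. K * norm x)"
  have p: "sublinear p"
    using K by (auto simp: sublinear_def p_def norm_triangle_ineq
        simp flip: distrib_left intro!: mult_left_mono)
  obtain r where r: "sublinear r" "\<And>x y. y \<in> Y \<Longrightarrow> r x \<le> p (x - y) + f y"
  proof (rule sublinear_inf_cone[OF p, of Y f])
    show "- p (- y) \<le> f y" if "y \<in> Y" for y
      using fbound[OF that] by (simp add: p_def)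
  qed (use Y fadd fscale in \<open>auto simp: subspace_def\<close>)
  obtain q where q: "sublinear q" "q \<le> r" "\<And>s. sublinear s \<Longrightarrow> s \<le> q \<Longrightarrow> s = q"
    using minimal_sublinear_exists[OF r(1)] by metis
  have lin: "linear q" using q by (intro minimal_sublinear_linear)
  have qneg: "q (- x) = - q x" for x using lin by (rule linear_neg)
  have qf: "q y \<le> f y" if "y \<in> Y" for y
    using le_funD[OF q(2), of y] r(2)[OF that, of y] by (simp add: p_def)
  have "f (- y) = - f y" if "y \<in> Y" for y using fscale[OF that, of "-1"] by simp
  then have "q y = f y" if "y \<in> Y" for y
    using qf[OF that] qf[of "- y"] that Y qneg[of y] by (simp add: subspace_neg)
  moreover have "q x \<le> K * norm x" for x
    using le_funD[OF q(2), of x] r(2)[of 0 x] fscale[of 0 0] Y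
    by (simp add: p_def subspace_0)
  then have "\<bar>q x\<bar> \<le> K * norm x" for x
    using qneg[of x] by (metis abs_leI norm_minus_cancel)
  ultimately show ?thesis using that lin by blast
qed

lemma norming_functional:
  fixes v :: "'a::real_normed_vector"
  obtains g where "linear g" "g v = norm v" "\<And>x. \<bar>g x\<bar> \<le> norm x"
proof (cases "v = 0")
  case True
  show ?thesis by (rule that[of "\<lambda>_. 0"]) (auto simp: True linear_iff)
next
  case False
  define f where "f y = (THE c. y = c *\<^sub>R v) * norm v" for y
  have f: "f (c *\<^sub>R v) = c * norm v" for c
    using False by (simp add: f_def)
  obtain g where g: "linear g" "\<And>y. y \<in> span {v} \<Longrightarrow> g y = f y" "\<And>x. \<bar>g x\<bar> \<le> 1 * norm x"
  proof (rule hahn_banach_norm[of "span {v}" f 1])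
    show "f (y + z) = f y + f z" if "y \<in> span {v}" "z \<in> span {v}" for y z
    proof -
      obtain a b where "y = a *\<^sub>R v" "z = b *\<^sub>R v"
        using \<open>y \<in> _\<close> \<open>z \<in> _\<close> unfolding span_singleton by blast
      then show ?thesis using f[of "a + b"] by (simp add: f scaleR_add_left distrib_right)
    qed
    show "f (c *\<^sub>R y) = c * f y" if "y \<in> span {v}" for c y
    proof -
      obtain a where "y = a *\<^sub>R v" using \<open>y \<in> _\<close> unfolding span_singleton by blast
      then show ?thesis using f[of "c * a"] by (simp add: f)
    qed
    show "\<bar>f y\<bar> \<le> 1 * norm y" if "y \<in> span {v}" for y
      using that by (auto simp: span_singleton f abs_mult)
  qed auto
  show ?thesis
    using g(1,3) g(2)[of v] f[of 1] by (intro that[of g]) (auto simp: span_base)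
qed

section \<open>Copies of \<open>c\<^sub>0\<close> from unconditionally bounded sums\<close>

text \<open>
  Rosenthal's lemma, by induction on the number \<open>n\<close> of times that \<open>\<delta>\<close> fits into a row. Split the
  indices into infinitely many infinite blocks. If no block works, then every block \<open>p\<close> contains an
  index \<open>k\<^sub>p\<close> whose row has mass more than \<open>\<delta>\<close> inside the block. The matrix of the indices
  \<open>k\<^sub>p\<close> does not see this mass, so its row sums are at most \<open>(n - 1) \<delta>\<close>.
\<close>

lemma rosenthal_disjointification:
  fixes a :: "nat \<Rightarrow> nat \<Rightarrow> real"
  assumes "0 \<le> \<delta>" and "\<And>k j. 0 \<le> a k j"
    and "\<And>k F. finite F \<Longrightarrow> k \<notin> F \<Longrightarrow> (\<Sum>j\<in>F. a k j) \<le> real n * \<delta>"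
  shows "\<exists>\<sigma>::nat \<Rightarrow> nat. inj \<sigma> \<and>
    (\<forall>k F. finite F \<longrightarrow> k \<notin> F \<longrightarrow> (\<Sum>j\<in>F. a (\<sigma> k) (\<sigma> j)) \<le> \<delta>)"
  using assms(2,3)
proof (induction n arbitrary: a)
  case 0
  show ?case
    using 0(2) \<open>0 \<le> \<delta>\<close> by (intro exI[of _ id]) (auto intro: order_trans)
next
  case (Suc n)
  \<comment> \<open>The block \<open>p\<close> is the range of \<open>enc p\<close>.\<close>
  define enc where "enc p q = prod_encode (p, q)" for p q :: nat
  have enc_eq: "enc p q = enc p' q' \<longleftrightarrow> p = p' \<and> q = q'" for p q p' q'
    by (simp add: enc_def)
  show ?case
  proof (cases "\<exists>p. \<forall>k F. finite F \<longrightarrow> k \<notin> F \<longrightarrow> (\<Sum>j\<in>F. a (enc p k) (enc p j)) \<le> \<delta>")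
    case True
    then obtain p where "\<forall>k F. finite F \<longrightarrow> k \<notin> F \<longrightarrow> (\<Sum>j\<in>F. a (enc p k) (enc p j)) \<le> \<delta>" ..
    then show ?thesis
      by (intro exI[of _ "enc p"]) (auto simp: inj_def enc_eq)
  next
    case False
    then have "\<forall>p. \<exists>k F. finite F \<and> k \<notin> F \<and> \<delta> < (\<Sum>j\<in>F. a (enc p k) (enc p j))"
      by (meson not_le)
    then obtain q H where H: "\<And>p. finite (H p)" "\<And>p. q p \<notin> H p"
      "\<And>p. \<delta> < (\<Sum>j\<in>H p. a (enc p (q p)) (enc p j))"
      by metis
    define s where "s p = enc p (q p)" for p
    have inj_s: "inj s" by (auto simp: inj_def s_def enc_eq)
    have "(\<Sum>j\<in>F. a (s k) (s j)) \<le> real n * \<delta>" if F: "finite F" "k \<notin> F" for k F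
    proof -
      have disj: "s ` F \<inter> enc k ` H k = {}" and notin: "s k \<notin> s ` F \<union> enc k ` H k"
        using F H(2)[of k] by (auto simp: s_def enc_eq)
      have "(\<Sum>j\<in>s ` F \<union> enc k ` H k. a (s k) j) \<le> real (Suc n) * \<delta>"
        using F H(1) notin by (intro Suc.prems(2)) auto
      also have "(\<Sum>j\<in>s ` F \<union> enc k ` H k. a (s k) j)
          = (\<Sum>j\<in>F. a (s k) (s j)) + (\<Sum>j\<in>H k. a (s k) (enc k j))"
        using F H(1) disj inj_on_subset[OF inj_s]
        by (subst sum.union_disjoint) (auto simp: sum.reindex inj_on_def enc_eq)
      finally show ?thesis using H(3)[of k] by (simp add: s_def algebra_simps)
    qed
    from Suc.IH[of "\<lambda>k j. a (s k) (s j)", OF Suc.prems(1) this]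
    obtain \<tau> :: "nat \<Rightarrow> nat" where \<tau>: "inj \<tau>"
      "\<forall>k F. finite F \<longrightarrow> k \<notin> F \<longrightarrow> (\<Sum>j\<in>F. a (s (\<tau> k)) (s (\<tau> j))) \<le> \<delta>"
      by blast
    show ?thesis
    proof (intro exI[of _ "s \<circ> \<tau>"] conjI)
      show "inj (s \<circ> \<tau>)" using inj_s \<tau>(1) by (rule inj_compose)
    qed (use \<tau>(2) in simp)
  qed
qed

lemma c0_imp_eventually_small:
  assumes "a \<in> c0" "0 < e"
  obtains N where "\<And>i. N \<le> i \<Longrightarrow> \<bar>apply_bcontfun a i\<bar> \<le> e"
proof -
  have "\<forall>\<^sub>F i in sequentially. dist (apply_bcontfun a i) 0 < e"
    using assms by (intro tendstoD) (auto simp: c0_def)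
  then show ?thesis using that by (auto simp: eventually_sequentially dist_real_def intro: less_imp_le)
qed

lemma isomorphism_onI_bounded_below:
  fixes V :: "'a::real_normed_vector \<Rightarrow> 'b::real_normed_vector"
  assumes X: "subspace X" and V: "bounded_linear_on X V"
    and d: "0 < d" and below: "\<And>x. x \<in> X \<Longrightarrow> d * norm x \<le> norm (V x)"
  shows "subspace (V ` X)" and "isomorphism_on X (V ` X) V"
proof -
  have add: "V (x + y) = V x + V y" if "x \<in> X" "y \<in> X" for x y
    using V that by (auto simp: bounded_linear_on_def)
  have scale: "V (c *\<^sub>R x) = c *\<^sub>R V x" if "x \<in> X" for c x
    using V that by (auto simp: bounded_linear_on_def)
  have V0: "V 0 = 0" using scale[of 0 0] X by (simp add: subspace_0)
  show sub: "subspace (V ` X)"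
    unfolding subspace_def
  proof (intro conjI ballI allI)
    show "0 \<in> V ` X" using V0 X by (metis imageI subspace_0)
    show "u + v \<in> V ` X" if "u \<in> V ` X" "v \<in> V ` X" for u v
      using that X by (auto simp flip: add intro: subspace_add)
    show "c *\<^sub>R u \<in> V ` X" if "u \<in> V ` X" for c u
      using that X by (auto simp flip: scale intro: subspace_scale)
  qed
  have inj: "inj_on V X"
  proof (rule inj_onI)
    fix x y assume xy: "x \<in> X" "y \<in> X" "V x = V y"
    have "V (x - y) = 0"
      using add[of x "- y"] scale[of y "-1"] xy X by (simp add: subspace_neg)
    then have "d * norm (x - y) \<le> 0" using below[of "x - y"] xy X by (simp add: subspace_diff)
    then show "x = y" using d by (simp add: mult_le_0_iff)
  qed
  have inv: "inv_into X V (V x) = x" if "x \<in> X" for x using inj that by simp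
  have "bounded_linear_on (V ` X) (inv_into X V)"
    unfolding bounded_linear_on_def
  proof (intro conjI ballI allI exI)
    show "inv_into X V (u + v) = inv_into X V u + inv_into X V v"
      if "u \<in> V ` X" "v \<in> V ` X" for u v
      using that X by (auto simp: inv subspace_add simp flip: add)
    show "inv_into X V (c *\<^sub>R u) = c *\<^sub>R inv_into X V u" if "u \<in> V ` X" for c u
      using that X by (auto simp: inv subspace_scale simp flip: scale)
    show "norm (inv_into X V u) \<le> norm u * (1 / d)" if "u \<in> V ` X" for u
      using that below d by (auto simp: inv field_simps)
  qed
  then show "isomorphism_on X (V ` X) V"
    using inj V by (simp add: isomorphism_on_def bij_betw_def)
qed

text \<open>
  After Rosenthal's lemma, the functional \<open>f\<^sub>k\<close> that norms \<open>x\<^sub>k\<close> reads off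
  \<open>\<epsilon> \<bar>a\<^sub>k\<bar>\<close> from \<open>\<Sum> a\<^sub>j x\<^sub>j\<close> up to an error of \<open>\<epsilon> \<parallel>a\<parallel> / 2\<close>. Taking the supremum over \<open>k\<close>
  bounds the operator \<open>a \<mapsto> \<Sum> a\<^sub>j x\<^sub>j\<close> on \<open>c\<^sub>0\<close> from below. The series converges because the
  coefficients of its tails are small.
\<close>

lemma contains_c0_if_unconditionally_bounded:
  fixes x :: "nat \<Rightarrow> 'a::banach"
  assumes upper: "\<And>F a c. finite F \<Longrightarrow> 0 \<le> c \<Longrightarrow> (\<And>k. k \<in> F \<Longrightarrow> \<bar>a k\<bar> \<le> c) \<Longrightarrow>
      norm (\<Sum>k\<in>F. a k *\<^sub>R x k) \<le> K * c"
    and eps: "0 < \<epsilon>" and lower: "\<And>k. \<epsilon> \<le> norm (x k)"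
  shows "contains_c0 TYPE('a)"
proof -
  have "\<forall>k. \<exists>g. linear g \<and> g (x k) = norm (x k) \<and> (\<forall>v. \<bar>g v\<bar> \<le> norm v)"
    by (metis norming_functional)
  then obtain f where flin: "\<And>k. linear (f k)" and fx: "\<And>k. f k (x k) = norm (x k)"
    and fle: "\<And>k v. \<bar>f k v\<bar> \<le> norm v"
    by metis
  have row: "(\<Sum>j\<in>F. \<bar>f k (x j)\<bar>) \<le> K" if "finite F" for k F
  proof -
    \<comment> \<open>Choosing the signs as coefficients turns the row sum into one value of \<open>f k\<close>.\<close>
    have "(\<Sum>j\<in>F. \<bar>f k (x j)\<bar>) = f k (\<Sum>j\<in>F. sgn (f k (x j)) *\<^sub>R x j)"
      by (simp add: linear_sum[OF flin] linear_scale[OF flin] abs_sgn mult.commute)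
    also have "\<dots> \<le> norm (\<Sum>j\<in>F. sgn (f k (x j)) *\<^sub>R x j)"
      using fle[of k] by (meson abs_le_D1)
    also have "\<dots> \<le> K * 1"
      using that by (intro upper) (auto simp: sgn_if)
    finally show ?thesis by simp
  qed
  obtain n :: nat where n: "K \<le> real n * (\<epsilon> / 2)"
    using reals_Archimedean3[of "\<epsilon> / 2"] eps by (metis half_gt_zero less_imp_le)
  obtain \<sigma> :: "nat \<Rightarrow> nat" where \<sigma>: "inj \<sigma>"
    and off: "\<And>k F. finite F \<Longrightarrow> k \<notin> F \<Longrightarrow> (\<Sum>j\<in>F. \<bar>f (\<sigma> k) (x (\<sigma> j))\<bar>) \<le> \<epsilon> / 2"
  proof -
    have "\<exists>\<sigma>::nat \<Rightarrow> nat. inj \<sigma> \<and>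
        (\<forall>k F. finite F \<longrightarrow> k \<notin> F \<longrightarrow> (\<Sum>j\<in>F. \<bar>f (\<sigma> k) (x (\<sigma> j))\<bar>) \<le> \<epsilon> / 2)"
      using eps by (intro rosenthal_disjointification[where n = n])
        (use order_trans[OF row n] in auto)
    then show ?thesis using that by blast
  qed
  define z where "z k = x (\<sigma> k)" for k
  have zupper: "norm (\<Sum>k\<in>F. a k *\<^sub>R z k) \<le> K * c"
    if "finite F" "0 \<le> c" "\<And>k. k \<in> F \<Longrightarrow> \<bar>a k\<bar> \<le> c" for F a c
  proof -
    have "norm (\<Sum>k\<in>\<sigma> ` F. a (inv \<sigma> k) *\<^sub>R x k) \<le> K * c"
      using that \<sigma> by (intro upper) auto
    also have "(\<Sum>k\<in>\<sigma> ` F. a (inv \<sigma> k) *\<^sub>R x k) = (\<Sum>k\<in>F. a k *\<^sub>R z k)"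
      using \<sigma> by (subst sum.reindex) (auto simp: z_def inj_on_def)
    finally show ?thesis .
  qed
  have K: "0 \<le> K" using row[of "{}"] by simp
  have summable: "summable (\<lambda>k. apply_bcontfun a k *\<^sub>R z k)" if a: "a \<in> c0" for a
    unfolding summable_Cauchy
  proof (intro allI impI)
    fix e :: real assume "0 < e"
    define e' where "e' = e / (2 * (K + 1))"
    have e': "0 < e'" using \<open>0 < e\<close> K by (simp add: e'_def)
    obtain N where N: "\<And>i. N \<le> i \<Longrightarrow> \<bar>apply_bcontfun a i\<bar> \<le> e'"
      using c0_imp_eventually_small[OF a e'] by blast
    have "norm (\<Sum>k\<in>{m..<n}. apply_bcontfun a k *\<^sub>R z k) < e" if "N \<le> m" for m n
    proof -
      have "norm (\<Sum>k\<in>{m..<n}. apply_bcontfun a k *\<^sub>R z k) \<le> K * e'"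
        using N that e' by (intro zupper) auto
      also have "\<dots> < (K + 1) * e'" using e' by (simp add: distrib_right)
      also have "\<dots> = e / 2" using K unfolding e'_def by (simp add: divide_simps)
      also have "\<dots> < e" using \<open>0 < e\<close> by simp
      finally show ?thesis .
    qed
    then show "\<exists>N. \<forall>m\<ge>N. \<forall>n. norm (\<Sum>k\<in>{m..<n}. apply_bcontfun a k *\<^sub>R z k) < e" by blast
  qed
  define V where "V a = (\<Sum>k. apply_bcontfun a k *\<^sub>R z k)" for a :: linf
  have V_lim: "(\<lambda>n. \<Sum>k<n. apply_bcontfun a k *\<^sub>R z k) \<longlonglongrightarrow> V a" if "a \<in> c0" for a
    using summable[OF that] by (simp add: V_def summable_LIMSEQ)
  have coord: "\<bar>apply_bcontfun a k\<bar> \<le> norm a" for a :: linf and k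
    using linf_norm_le_iff[of a "norm a"] by simp
  have V: "bounded_linear_on c0 V"
    unfolding bounded_linear_on_def
  proof (intro conjI ballI allI exI)
    show "V (a + b) = V a + V b" if "a \<in> c0" "b \<in> c0" for a b
      using suminf_add[OF summable[OF that(1)] summable[OF that(2)]]
      by (simp add: V_def plus_bcontfun.rep_eq scaleR_add_left)
    show "V (r *\<^sub>R a) = r *\<^sub>R V a" if "a \<in> c0" for r a
      using suminf_scaleR_right[OF summable[OF that], of r]
      by (simp add: V_def scaleR_bcontfun.rep_eq)
    show "norm (V a) \<le> norm a * K" if "a \<in> c0" for a
    proof (rule LIMSEQ_le_const2[OF tendsto_norm[OF V_lim[OF that]]])
      show "\<exists>N. \<forall>n\<ge>N. norm (\<Sum>k<n. apply_bcontfun a k *\<^sub>R z k) \<le> norm a * K"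
        using zupper[of "{..<_}" "norm a" "apply_bcontfun a"] coord by (simp add: mult.commute)
    qed
  qed
  have below: "\<epsilon> / 2 * norm a \<le> norm (V a)" if a: "a \<in> c0" for a
  proof -
    have "\<epsilon> * \<bar>apply_bcontfun a k\<bar> - \<epsilon> / 2 * norm a \<le> norm (V a)" for k
    proof (rule LIMSEQ_le_const[OF tendsto_norm[OF V_lim[OF a]]], intro exI allI impI)
      fix n assume n: "Suc k \<le> n"
      let ?s = "\<Sum>j<n. apply_bcontfun a j *\<^sub>R z j"
      have "f (\<sigma> k) ?s = (\<Sum>j<n. apply_bcontfun a j * f (\<sigma> k) (z j))"
        by (simp add: linear_sum[OF flin] linear_scale[OF flin])
      also have "\<dots> = apply_bcontfun a k * f (\<sigma> k) (z k)
          + (\<Sum>j\<in>{..<n} - {k}. apply_bcontfun a j * f (\<sigma> k) (z j))"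
        using n by (subst sum.remove[of _ k]) auto
      finally have eq: "f (\<sigma> k) ?s = apply_bcontfun a k * norm (z k)
          + (\<Sum>j\<in>{..<n} - {k}. apply_bcontfun a j * f (\<sigma> k) (z j))"
        by (simp add: z_def fx)
      have "\<bar>\<Sum>j\<in>{..<n} - {k}. apply_bcontfun a j * f (\<sigma> k) (z j)\<bar>
          \<le> (\<Sum>j\<in>{..<n} - {k}. norm a * \<bar>f (\<sigma> k) (z j)\<bar>)"
        by (rule order_trans[OF sum_abs])
          (auto simp: abs_mult intro!: sum_mono mult_right_mono coord)
      also have "\<dots> \<le> norm a * (\<epsilon> / 2)"
        unfolding sum_distrib_left[symmetric] z_def by (intro mult_left_mono off) auto
      finally have rest: "\<bar>\<Sum>j\<in>{..<n} - {k}. apply_bcontfun a j * f (\<sigma> k) (z j)\<bar>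
          \<le> norm a * (\<epsilon> / 2)" .
      have "\<epsilon> * \<bar>apply_bcontfun a k\<bar> \<le> \<bar>apply_bcontfun a k * norm (z k)\<bar>"
        using mult_right_mono[OF lower[of "\<sigma> k"] abs_ge_zero[of "apply_bcontfun a k"]]
        by (simp add: abs_mult z_def mult.commute)
      also have "\<dots> \<le> norm ?s + norm a * (\<epsilon> / 2)"
        using eq rest fle[of "\<sigma> k" ?s] by linarith
      finally show "\<epsilon> * \<bar>apply_bcontfun a k\<bar> - \<epsilon> / 2 * norm a \<le> norm ?s" by (simp add: mult.commute)
    qed
    then have "\<bar>apply_bcontfun a k\<bar> \<le> (norm (V a) + \<epsilon> / 2 * norm a) / \<epsilon>" for k
      using eps by (simp add: pos_le_divide_eq algebra_simps)
    then have "norm a \<le> (norm (V a) + \<epsilon> / 2 * norm a) / \<epsilon>"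
      by (simp add: linf_norm_le_iff)
    then show ?thesis using eps by (simp add: pos_le_divide_eq algebra_simps)
  qed
  show ?thesis
    using isomorphism_onI_bounded_below[OF subspace_c0 V _ below] eps
    by (auto simp: contains_c0_def isomorphic_spaces_def)
qed

section \<open>Compactness of operators on subspaces of \<open>c\<^sub>0\<close>\<close>

text \<open>
  Choose the vectors successively and keep track of the sequence \<open>i \<mapsto> \<Sum> \<bar>u\<^sub>j i\<bar>\<close>
  over \<open>j < k\<close>, which tends to \<open>0\<close> and is at most \<open>3 - (1/2)^k\<close>. Beyond some index \<open>N\<close> it is
  less than \<open>1/2\<close>, which leaves room for a vector of norm at most \<open>2\<close>; before \<open>N\<close> the next
  vector is chosen with coordinates at most \<open>(1/2)^(k + 1)\<close>.
\<close>

lemma gliding_hump: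
  fixes W :: "linf set"
  assumes W: "W \<subseteq> c0"
    and pick: "\<And>N \<delta>. 0 < \<delta> \<Longrightarrow>
      \<exists>u\<in>W. norm u \<le> 2 \<and> (\<forall>i<N. \<bar>apply_bcontfun u i\<bar> \<le> \<delta>)"
  obtains u :: "nat \<Rightarrow> linf" where "\<And>k. u k \<in> W"
    and "\<And>F i. finite F \<Longrightarrow> (\<Sum>k\<in>F. \<bar>apply_bcontfun (u k) i\<bar>) \<le> 3"
proof -
  \<comment> \<open>A state pairs the latest vector with the sum of absolute values so far; the vector of the
    initial state is a dummy that is not counted.\<close>
  define P where "P k s \<longleftrightarrow> fst s \<in> W \<and> snd s \<longlonglongrightarrow> 0 \<and>
      (\<forall>i. 0 \<le> snd s i \<and> snd s i \<le> 3 - (1/2) ^ k)"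
    for k and s :: "linf \<times> (nat \<Rightarrow> real)"
  define Q where "Q s s' \<longleftrightarrow> snd s' = (\<lambda>i. snd s i + \<bar>apply_bcontfun (fst s') i\<bar>)"
    for s s' :: "linf \<times> (nat \<Rightarrow> real)"
  have "\<exists>s. \<forall>k. P k (s k) \<and> Q (s k) (s (Suc k))"
  proof (rule dependent_nat_choice)
    obtain u where "u \<in> W" using pick[of 1 0] by auto
    then show "\<exists>s. P 0 s" by (intro exI[of _ "(u, \<lambda>_. 0)"]) (simp add: P_def)
  next
    fix s k assume "P k s"
    then have g: "snd s \<longlonglongrightarrow> 0" "\<And>i. snd s i \<le> 3 - (1/2) ^ k" "\<And>i. 0 \<le> snd s i" by (auto simp: P_def)
    have "\<forall>\<^sub>F i in sequentially. dist (snd s i) 0 < 1/2"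
      using g(1) by (intro tendstoD) auto
    then obtain N where N: "\<And>i. N \<le> i \<Longrightarrow> snd s i < 1/2"
      unfolding eventually_sequentially dist_real_def
      by (metis abs_ge_self diff_zero le_less_trans)
    obtain u where u: "u \<in> W" "norm u \<le> 2" "\<And>i. i < N \<Longrightarrow> \<bar>apply_bcontfun u i\<bar> \<le> (1/2) ^ Suc k"
      using pick[of "(1/2) ^ Suc k" N] by auto
    have u2: "\<bar>apply_bcontfun u i\<bar> \<le> 2" for i using u(2) by (simp add: linf_norm_le_iff)
    let ?s = "(u, \<lambda>i. snd s i + \<bar>apply_bcontfun u i\<bar>)"
    have half: "(1/2 :: real) ^ Suc k \<le> 1/2" by (simp add: power_le_one)
    have "snd s i + \<bar>apply_bcontfun u i\<bar> \<le> 3 - (1/2) ^ Suc k" for i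
    proof (cases "i < N")
      case True
      then show ?thesis using g(2)[of i] u(3)[of i] by simp
    next
      case False
      then show ?thesis using N[of i] u2[of i] half by simp
    qed
    moreover have "(\<lambda>i. snd s i + \<bar>apply_bcontfun u i\<bar>) \<longlonglongrightarrow> 0"
      using g(1) u(1) W by (auto simp: c0_def intro!: tendsto_add_zero tendsto_rabs_zero)
    ultimately show "\<exists>s'. P (Suc k) s' \<and> Q s s'"
      using u(1) g(3) by (intro exI[of _ ?s]) (simp add: P_def Q_def)
  qed
  then obtain s where s: "\<And>k. P k (s k)" "\<And>k. Q (s k) (s (Suc k))" by blast
  define u where "u k = fst (s (Suc k))" for k
  have eq: "snd (s k) i = snd (s 0) i + (\<Sum>j<k. \<bar>apply_bcontfun (u j) i\<bar>)" for k i
    using s(2) by (induction k) (auto simp: Q_def u_def)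
  show ?thesis
  proof (rule that[of u])
    show "u k \<in> W" for k using s(1)[of "Suc k"] by (simp add: P_def u_def)
    show "(\<Sum>k\<in>F. \<bar>apply_bcontfun (u k) i\<bar>) \<le> 3" if F: "finite F" for F i
    proof -
      obtain n where "F \<subseteq> {..<n}" using F by (meson finite_nat_bounded)
      then have "(\<Sum>k\<in>F. \<bar>apply_bcontfun (u k) i\<bar>) \<le> (\<Sum>k<n. \<bar>apply_bcontfun (u k) i\<bar>)"
        by (intro sum_mono2) auto
      also have "\<dots> \<le> snd (s n) i" using eq[of n i] s(1)[of 0] by (simp add: P_def)
      also have "\<dots> \<le> 3 - (1/2) ^ n" using s(1)[of n] by (simp add: P_def)
      also have "\<dots> \<le> 3" by simp
      finally show ?thesis .
    qed
  qed
qed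

text \<open>
  Rounding the first \<open>N\<close> coordinates to multiples of \<open>\<delta>\<close> sorts the unit ball of \<open>Y\<close> into finitely
  many classes. The difference of two vectors of one class has norm at most \<open>2\<close> and small first
  coordinates, so one representative of each class gives an \<open>\<epsilon>\<close>-net of the image.
\<close>

lemma finite_net_of_small_oscillation:
  fixes t :: "linf \<Rightarrow> 'b::real_normed_vector"
  assumes Y: "subspace Y" and t: "bounded_linear_on Y t" and \<delta>: "0 < \<delta>"
    and small: "\<And>u. u \<in> Y \<Longrightarrow> norm u \<le> 2 \<Longrightarrow> (\<And>i. i < N \<Longrightarrow> \<bar>apply_bcontfun u i\<bar> \<le> \<delta>) \<Longrightarrow>
      norm (t u) < \<epsilon>"
  obtains A where "finite A" "\<And>y. y \<in> Y \<Longrightarrow> norm y \<le> 1 \<Longrightarrow> \<exists>a\<in>A. norm (t y - a) < \<epsilon>"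
proof -
  define B where "B = {y \<in> Y. norm y \<le> 1}"
  define c where "c y = restrict (\<lambda>i. \<lfloor>apply_bcontfun y i / \<delta>\<rfloor>) {..<N}" for y :: linf
  have "c ` B \<subseteq> {..<N} \<rightarrow>\<^sub>E {\<lfloor>- 1 / \<delta>\<rfloor>..\<lfloor>1 / \<delta>\<rfloor>}"
  proof
    fix d assume "d \<in> c ` B"
    then obtain y where y: "norm y \<le> 1" "d = c y" by (auto simp: B_def)
    have "- 1 \<le> apply_bcontfun y i" "apply_bcontfun y i \<le> 1" for i
      using y(1) by (auto simp: linf_norm_le_iff abs_le_iff dest!: spec[of _ i])
    then have "\<lfloor>- 1 / \<delta>\<rfloor> \<le> \<lfloor>apply_bcontfun y i / \<delta>\<rfloor>" "\<lfloor>apply_bcontfun y i / \<delta>\<rfloor> \<le> \<lfloor>1 / \<delta>\<rfloor>" for i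
      using \<delta> by (intro floor_mono divide_right_mono; simp)+
    then show "d \<in> {..<N} \<rightarrow>\<^sub>E {\<lfloor>- 1 / \<delta>\<rfloor>..\<lfloor>1 / \<delta>\<rfloor>}" by (simp add: y(2) c_def)
  qed
  then have fin: "finite (c ` B)" by (rule finite_subset) (simp add: finite_PiE)
  define A where "A = (\<lambda>d. t (inv_into B c d)) ` c ` B"
  show ?thesis
  proof (rule that[of A])
    show "finite A" using fin by (simp add: A_def)
    fix y assume "y \<in> Y" "norm y \<le> 1"
    then have y: "y \<in> B" by (simp add: B_def)
    define z where "z = inv_into B c (c y)"
    have z: "z \<in> B" "c z = c y" using y by (auto simp: z_def inv_into_into f_inv_into_f)
    have yz: "y \<in> Y" "z \<in> Y" using y z by (auto simp: B_def)
    have "norm (t (y - z)) < \<epsilon>"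
    proof (rule small)
      show "y - z \<in> Y" using yz Y by (simp add: subspace_diff)
      show "norm (y - z) \<le> 2"
        using y z norm_triangle_ineq4[of y z] by (simp add: B_def)
      fix i assume i: "i < N"
      have "c y i = c z i" using z by simp
      then have eq: "\<lfloor>apply_bcontfun y i / \<delta>\<rfloor> = \<lfloor>apply_bcontfun z i / \<delta>\<rfloor>"
        using i by (simp add: c_def)
      have "\<bar>apply_bcontfun y i / \<delta> - apply_bcontfun z i / \<delta>\<bar> \<le> 1"
        using eq by linarith
      then have "\<bar>apply_bcontfun y i - apply_bcontfun z i\<bar> / \<delta> \<le> 1"
        using \<delta> by (simp add: diff_divide_distrib[symmetric])
      then show "\<bar>apply_bcontfun (y - z) i\<bar> \<le> \<delta>"
        using \<delta> by (simp add: minus_bcontfun.rep_eq field_simps)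
    qed
    moreover have "t (y - z) = t y - t z"
    proof -
      have "t (y + (-1) *\<^sub>R z) = t y + (-1) *\<^sub>R t z"
        using t yz subspace_scale[OF Y yz(2), of "-1"] unfolding bounded_linear_on_def by metis
      then show ?thesis by simp
    qed
    moreover have "t z \<in> A" using y by (auto simp: A_def z_def)
    ultimately show "\<exists>a\<in>A. norm (t y - a) < \<epsilon>" by auto
  qed
qed

text \<open>
  The dichotomy between the two lemmas above: either \<open>t\<close> is small on the vectors with small first
  coordinates, or the vectors on which it is not small feed the gliding hump, and their images span
  a copy of \<open>c\<^sub>0\<close>.
\<close>

lemma totally_bounded_image_if_no_c0:
  fixes t :: "linf \<Rightarrow> 'a::banach"
  assumes no_c0: "\<not> contains_c0 TYPE('a)"
    and Y: "subspace Y" "Y \<subseteq> c0" and t: "bounded_linear_on Y t" and \<epsilon>: "0 < \<epsilon>"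
  obtains A where "finite A" "\<And>y. y \<in> Y \<Longrightarrow> norm y \<le> 1 \<Longrightarrow> \<exists>a\<in>A. norm (t y - a) < \<epsilon>"
proof (cases "\<exists>N. \<exists>\<delta>>0. \<forall>u\<in>Y. norm u \<le> 2 \<longrightarrow> (\<forall>i<N. \<bar>apply_bcontfun u i\<bar> \<le> \<delta>) \<longrightarrow>
      norm (t u) < \<epsilon>")
  case True
  then obtain N \<delta> where "0 < \<delta>" "\<And>u. u \<in> Y \<Longrightarrow> norm u \<le> 2 \<Longrightarrow>
      (\<And>i. i < N \<Longrightarrow> \<bar>apply_bcontfun u i\<bar> \<le> \<delta>) \<Longrightarrow> norm (t u) < \<epsilon>"
    by blast
  then show ?thesis using that finite_net_of_small_oscillation[OF Y(1) t] by metis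
next
  case False
  define W where "W = {u \<in> Y. \<epsilon> \<le> norm (t u)}"
  have "\<exists>u\<in>W. norm u \<le> 2 \<and> (\<forall>i<N. \<bar>apply_bcontfun u i\<bar> \<le> \<delta>)" if "0 < \<delta>" for N \<delta>
  proof -
    have "\<not> (\<forall>u\<in>Y. norm u \<le> 2 \<longrightarrow> (\<forall>i<N. \<bar>apply_bcontfun u i\<bar> \<le> \<delta>) \<longrightarrow> norm (t u) < \<epsilon>)"
      using False that by blast
    then show ?thesis unfolding W_def by (auto simp: not_less)
  qed
  moreover have "W \<subseteq> c0" using Y(2) by (auto simp: W_def)
  ultimately obtain u :: "nat \<Rightarrow> linf" where uW: "\<And>k. u k \<in> W"
    and usum: "\<And>F i. finite F \<Longrightarrow> (\<Sum>k\<in>F. \<bar>apply_bcontfun (u k) i\<bar>) \<le> 3"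
    using gliding_hump by blast
  have uY: "u k \<in> Y" for k using uW by (simp add: W_def)
  have tadd: "t (x + y) = t x + t y" if "x \<in> Y" "y \<in> Y" for x y
    using t that by (simp add: bounded_linear_on_def)
  have tscale: "t (c *\<^sub>R x) = c *\<^sub>R t x" if "x \<in> Y" for c x
    using t that by (simp add: bounded_linear_on_def)
  have tsum: "t (\<Sum>k\<in>F. a k *\<^sub>R u k) = (\<Sum>k\<in>F. a k *\<^sub>R t (u k))" if "finite F" for F a
    using that
  proof (induction F)
    case empty
    then show ?case using tscale[of 0 0] Y(1) by (simp add: subspace_0)
  next
    case (insert k F)
    have "(\<Sum>k\<in>F. a k *\<^sub>R u k) \<in> Y"
      using uY Y(1) by (intro subspace_sum) (auto simp: subspace_scale)
    then show ?case using insert uY Y(1) by (simp add: tadd tscale subspace_scale)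
  qed
  obtain L where L: "\<And>y. y \<in> Y \<Longrightarrow> norm (t y) \<le> norm y * L" "0 \<le> L"
  proof -
    obtain L where L: "\<And>y. y \<in> Y \<Longrightarrow> norm (t y) \<le> norm y * L"
      using t unfolding bounded_linear_on_def by blast
    have "norm (t y) \<le> norm y * max L 0" if "y \<in> Y" for y
      by (rule order_trans[OF L[OF that]]) (simp add: mult_left_mono)
    then show ?thesis by (rule that) auto
  qed
  have coord: "apply_bcontfun (\<Sum>k\<in>F. a k *\<^sub>R u k) i = (\<Sum>k\<in>F. a k * apply_bcontfun (u k) i)"
    for F i and a :: "nat \<Rightarrow> real"
    by (induction F rule: infinite_finite_induct)
      (auto simp: zero_bcontfun.rep_eq plus_bcontfun.rep_eq scaleR_bcontfun.rep_eq)
  have "contains_c0 TYPE('a)"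
  proof (rule contains_c0_if_unconditionally_bounded[OF _ \<epsilon>])
    show "\<epsilon> \<le> norm (t (u k))" for k using uW by (simp add: W_def)
    fix F and a :: "nat \<Rightarrow> real" and c :: real
    assume F: "finite F" and c: "0 \<le> c" and a: "\<And>k. k \<in> F \<Longrightarrow> \<bar>a k\<bar> \<le> c"
    have "\<bar>apply_bcontfun (\<Sum>k\<in>F. a k *\<^sub>R u k) i\<bar> \<le> c * 3" for i
    proof -
      have "\<bar>\<Sum>k\<in>F. a k * apply_bcontfun (u k) i\<bar> \<le> (\<Sum>k\<in>F. c * \<bar>apply_bcontfun (u k) i\<bar>)"
        by (rule order_trans[OF sum_abs]) (auto simp: abs_mult intro!: sum_mono mult_right_mono a)
      also have "\<dots> \<le> c * 3"
        unfolding sum_distrib_left[symmetric] using c by (intro mult_left_mono usum F)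
      finally show ?thesis by (simp add: coord)
    qed
    then have "norm (\<Sum>k\<in>F. a k *\<^sub>R u k) \<le> c * 3" by (simp add: linf_norm_le_iff)
    then have "norm (\<Sum>k\<in>F. a k *\<^sub>R u k) * L \<le> (c * 3) * L" using L(2) by (rule mult_right_mono)
    moreover have "(\<Sum>k\<in>F. a k *\<^sub>R u k) \<in> Y"
      using uY Y(1) by (intro subspace_sum) (auto simp: subspace_scale)
    then have "norm (t (\<Sum>k\<in>F. a k *\<^sub>R u k)) \<le> norm (\<Sum>k\<in>F. a k *\<^sub>R u k) * L" by (rule L(1))
    ultimately show "norm (\<Sum>k\<in>F. a k *\<^sub>R t (u k)) \<le> (3 * L) * c"
      unfolding tsum[OF F] by (simp add: mult_ac)
  qed
  with no_c0 show ?thesis by blast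
qed

section \<open>Injectivity of spaces close to \<open>\<ell>\<^sub>\<infinity>\<^sup>n\<close>\<close>

lemma ratio_le_onorm_on:
  assumes "bounded_linear_on X T" "x \<in> X"
  shows "norm (T x) / norm x \<le> onorm_on X T"
proof -
  obtain K where K: "\<And>x. x \<in> X \<Longrightarrow> norm (T x) \<le> norm x * K"
    using assms unfolding bounded_linear_on_def by blast
  have "norm (T x) / norm x \<le> max K 0" if "x \<in> X" for x
  proof (cases "x = 0")
    case False
    then have "norm (T x) / norm x \<le> K"
      using K[OF that] by (simp add: pos_divide_le_eq mult.commute)
    then show ?thesis by simp
  qed simp
  then show ?thesis
    unfolding onorm_on_def using assms by (intro cSUP_upper bdd_aboveI2) auto
qed

lemma onorm_on_nonneg:
  assumes "bounded_linear_on X T" "x \<in> X"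
  shows "0 \<le> onorm_on X T"
  using ratio_le_onorm_on[OF assms] by (rule order_trans[rotated]) simp

lemma norm_le_onorm_on:
  assumes "bounded_linear_on X T" "x \<in> X"
  shows "norm (T x) \<le> onorm_on X T * norm x"
proof (cases "x = 0")
  case True
  have "T (0 *\<^sub>R x) = 0 *\<^sub>R T x" using assms by (simp only: bounded_linear_on_def)
  then show ?thesis using True by simp
next
  case False
  then show ?thesis using ratio_le_onorm_on[OF assms] by (simp add: pos_divide_le_eq)
qed

text \<open>
  The space \<open>\<ell>\<^sub>\<infinity>\<^sup>n\<close> is injective with constant \<open>1\<close>, since the coordinates of an operator into it
  can be extended one by one with their norms preserved. An isomorphism with \<open>G\<close> transports this to
  \<open>G\<close>, at the cost of the norms of the isomorphism and its inverse. The strict inequality in the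
  hypothesis provides an isomorphism with distortion below \<open>C\<close>, whether or not the
  infimum that defines the distance is attained.
\<close>

lemma extension_into_near_linf_dim:
  fixes G :: "'a::real_normed_vector set" and u :: "'x::real_normed_vector \<Rightarrow> 'a"
  assumes BM: "banach_mazur G (linf_dim n) < ereal C"
    and Y: "subspace Y" and u: "bounded_linear_on Y u" and uG: "\<And>y. y \<in> Y \<Longrightarrow> u y \<in> G"
    and uK: "\<And>y. y \<in> Y \<Longrightarrow> norm (u y) \<le> K * norm y" and K: "0 \<le> K"
  obtains U where "linear U" "\<And>y. y \<in> Y \<Longrightarrow> U y = u y" "range U \<subseteq> G"
    "\<And>x. norm (U x) \<le> C * K * norm x"
proof -
  obtain J where J: "isomorphism_on G (linf_dim n) J"
    and JC: "onorm_on G J * onorm_on (linf_dim n) (inv_into G J) < C"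
    using BM unfolding banach_mazur_def INF_less_iff by auto
  define I where "I = inv_into G J"
  have bij: "bij_betw J G (linf_dim n)" and Jbl: "bounded_linear_on G J"
    and Ibl: "bounded_linear_on (linf_dim n) I"
    using J by (auto simp: isomorphism_on_def I_def)
  have IJ: "I (J x) = x" if "x \<in> G" for x
    using bij that by (simp add: I_def bij_betw_inv_into_left)
  have IG: "I a \<in> G" if "a \<in> linf_dim n" for a
    using bij that by (simp add: I_def bij_betw_def inv_into_into)
  have Jmem: "J x \<in> linf_dim n" if "x \<in> G" for x using bij that by (auto simp: bij_betw_def)
  have Imem: "0 \<in> linf_dim n" using subspace_linf_dim by (rule subspace_0)
  define \<alpha> where "\<alpha> = onorm_on G J"
  define \<beta> where "\<beta> = onorm_on (linf_dim n) I"
  have \<alpha>: "0 \<le> \<alpha>" and \<beta>: "0 \<le> \<beta>"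
    using onorm_on_nonneg[OF Jbl IG[OF Imem]] onorm_on_nonneg[OF Ibl Imem]
    by (simp_all add: \<alpha>_def \<beta>_def)
  have J\<alpha>: "norm (J x) \<le> \<alpha> * norm x" if "x \<in> G" for x
    using norm_le_onorm_on[OF Jbl that] by (simp add: \<alpha>_def)
  have I\<beta>: "norm (I a) \<le> \<beta> * norm a" if "a \<in> linf_dim n" for a
    using norm_le_onorm_on[OF Ibl that] by (simp add: \<beta>_def)
  have \<beta>\<alpha>: "\<beta> * \<alpha> \<le> C" using JC by (simp add: \<alpha>_def \<beta>_def I_def mult.commute)
  have "\<exists>g. linear g \<and> (\<forall>y\<in>Y. g y = apply_bcontfun (J (u y)) i) \<and> (\<forall>x. \<bar>g x\<bar> \<le> (\<alpha> * K) * norm x)"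
    for i
  proof -
    obtain g where "linear g" "\<And>y. y \<in> Y \<Longrightarrow> g y = apply_bcontfun (J (u y)) i"
      "\<And>x. \<bar>g x\<bar> \<le> (\<alpha> * K) * norm x"
    proof (rule hahn_banach_norm[OF Y, of "\<lambda>y. apply_bcontfun (J (u y)) i" "\<alpha> * K"])
      show "apply_bcontfun (J (u (y + z))) i = apply_bcontfun (J (u y)) i + apply_bcontfun (J (u z)) i"
        if "y \<in> Y" "z \<in> Y" for y z
        using that u Jbl uG by (simp add: bounded_linear_on_def plus_bcontfun.rep_eq)
      show "apply_bcontfun (J (u (c *\<^sub>R y))) i = c * apply_bcontfun (J (u y)) i"
        if "y \<in> Y" for c y
        using that u Jbl uG by (simp add: bounded_linear_on_def scaleR_bcontfun.rep_eq)
      show "\<bar>apply_bcontfun (J (u y)) i\<bar> \<le> \<alpha> * K * norm y" if "y \<in> Y" for y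
      proof -
        have "\<bar>apply_bcontfun (J (u y)) i\<bar> \<le> norm (J (u y))"
          using linf_norm_le_iff[of "J (u y)" "norm (J (u y))"] by simp
        also have "\<dots> \<le> \<alpha> * norm (u y)" using that uG by (intro J\<alpha>)
        also have "\<dots> \<le> \<alpha> * (K * norm y)"
          using uK[OF that] by (intro mult_left_mono) (auto simp: \<alpha>)
        finally show ?thesis by (simp add: mult_ac)
      qed
      show "0 \<le> \<alpha> * K" using K by (simp add: \<alpha>)
    qed (rule that)
    then show ?thesis by blast
  qed
  then obtain g where glin: "\<And>i. linear (g i)" 
    and gY: "\<And>i y. y \<in> Y \<Longrightarrow> g i y = apply_bcontfun (J (u y)) i"
    and gle: "\<And>i x. \<bar>g i x\<bar> \<le> (\<alpha> * K) * norm x"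
    by metis
  define h where "h x = Bcontfun (\<lambda>i. if i < n then g i x else 0)" for x
  have happ: "apply_bcontfun (h x) i = (if i < n then g i x else 0)" for x i
  proof -
    have "(\<lambda>i. if i < n then g i x else 0) \<in> bcontfun"
      using gle[of _ x] K
      by (intro bcontfun_normI[where b = "\<alpha> * K * norm x"]) (auto simp: \<alpha>)
    then show ?thesis by (simp add: h_def Bcontfun_inverse)
  qed
  have hmem: "h x \<in> linf_dim n" for x by (simp add: linf_dim_def happ)
  have hnorm: "norm (h x) \<le> \<alpha> * K * norm x" for x
    using gle[of _ x] K by (auto simp: linf_norm_le_iff happ \<alpha>)
  have hadd: "h (x + y) = h x + h y" for x y
    by (rule bcontfun_eqI) (simp add: happ plus_bcontfun.rep_eq linear_add[OF glin])
  have hscale: "h (c *\<^sub>R x) = c *\<^sub>R h x" for c x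
    by (rule bcontfun_eqI) (simp add: happ scaleR_bcontfun.rep_eq linear_scale[OF glin])
  have hY: "h y = J (u y)" if "y \<in> Y" for y
    using Jmem[OF uG[OF that]]
    by (intro bcontfun_eqI) (auto simp: happ gY[OF that] linf_dim_def)
  show ?thesis
  proof (rule that[of "\<lambda>x. I (h x)"])
    show "linear (\<lambda>x. I (h x))"
      using Ibl hmem by (auto simp: linear_iff hadd hscale bounded_linear_on_def)
    show "I (h y) = u y" if "y \<in> Y" for y using that by (simp add: hY IJ uG)
    show "range (\<lambda>x. I (h x)) \<subseteq> G" using IG hmem by auto
    show "norm (I (h x)) \<le> C * K * norm x" for x
    proof -
      have "norm (I (h x)) \<le> \<beta> * (\<alpha> * K * norm x)"
        using I\<beta>[OF hmem, of x] hnorm[of x]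
        by (meson \<beta> mult_left_mono order_trans)
      also have "\<dots> = (\<beta> * \<alpha>) * (K * norm x)" by (simp add: mult_ac)
      also have "\<dots> \<le> C * (K * norm x)" using \<beta>\<alpha> K by (intro mult_right_mono) auto
      finally show ?thesis by (simp add: mult_ac)
    qed
  qed
qed

section \<open>Extension of compact operators\<close>

text \<open>
  The constant is increased by \<open>1\<close> so that the bound on the distance becomes strict.
\<close>

lemma L_infinity_spaceE:
  assumes "L_infinity_space TYPE('a::banach)"
  obtains C where "0 \<le> C" and "\<And>B::'a set. finite B \<Longrightarrow>
    \<exists>G n. fin_dim_subspace G \<and> span B \<subseteq> G \<and> banach_mazur G (linf_dim n) < ereal C"
proof -
  obtain \<mu> where \<mu>: "1 \<le> \<mu>" and ex: "\<And>F::'a set. fin_dim_subspace F \<Longrightarrow>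
      \<exists>G. fin_dim_subspace G \<and> F \<subseteq> G \<and> banach_mazur G (linf_dim (dim G)) \<le> ereal \<mu>"
    using assms unfolding L_infinity_space_def by blast
  show ?thesis
  proof (rule that[of "\<mu> + 1"])
    fix B :: "'a set" assume "finite B"
    then have "fin_dim_subspace (span B)" by (auto simp: fin_dim_subspace_def)
    from ex[OF this] obtain G where "fin_dim_subspace G" "span B \<subseteq> G"
      "banach_mazur G (linf_dim (dim G)) \<le> ereal \<mu>" by blast
    moreover have "ereal \<mu> < ereal (\<mu> + 1)" by simp
    ultimately show "\<exists>G n. fin_dim_subspace G \<and> span B \<subseteq> G \<and>
        banach_mazur G (linf_dim n) < ereal (\<mu> + 1)"
      by (meson le_less_trans)
  qed (use \<mu> in simp)
qed

text \<open>
  Extending the identity of \<open>G\<close> gives a projection \<open>P\<close> of norm at most \<open>C\<close> onto \<open>G\<close>. It fixes the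
  net \<open>A\<close>, so \<open>t y - P (t y) = (t y - a) - P (t y - a)\<close> for the point \<open>a\<close> of the net next to \<open>t y\<close>.
\<close>

lemma finite_rank_approximation:
  fixes t :: "'x::real_normed_vector \<Rightarrow> 'a::real_normed_vector"
  assumes C: "0 \<le> C" and G: "subspace G" "banach_mazur G (linf_dim n) < ereal C"
    and Y: "subspace Y" and t: "bounded_linear_on Y t"
    and A: "A \<subseteq> G" "\<And>y. y \<in> Y \<Longrightarrow> norm y \<le> 1 \<Longrightarrow> \<exists>a\<in>A. norm (t y - a) < \<epsilon>"
  obtains S where "bounded_linear_on Y S" "S ` Y \<subseteq> G"
    "\<And>y. y \<in> Y \<Longrightarrow> norm (t y - S y) \<le> (1 + C) * \<epsilon> * norm y"
proof -
  obtain P where P: "linear P" "\<And>g. g \<in> G \<Longrightarrow> P g = g" "range P \<subseteq> G"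
    "\<And>x. norm (P x) \<le> C * 1 * norm x"
    by (rule extension_into_near_linf_dim[OF G(2,1), of "\<lambda>g. g" 1])
      (auto simp: bounded_linear_on_def intro!: exI[of _ 1])
  obtain L where L: "\<And>y. y \<in> Y \<Longrightarrow> norm (t y) \<le> norm y * L"
    using t unfolding bounded_linear_on_def by blast
  have tadd: "t (x + y) = t x + t y" if "x \<in> Y" "y \<in> Y" for x y
    using t that by (simp add: bounded_linear_on_def)
  have tscale: "t (c *\<^sub>R x) = c *\<^sub>R t x" if "x \<in> Y" for c x
    using t that by (simp add: bounded_linear_on_def)
  show ?thesis
  proof (rule that[of "\<lambda>y. P (t y)"])
    show "bounded_linear_on Y (\<lambda>y. P (t y))"
      unfolding bounded_linear_on_def
    proof (intro conjI ballI allI exI)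
      show "norm (P (t y)) \<le> norm y * (C * L)" if "y \<in> Y" for y
        using P(4)[of "t y"] mult_left_mono[OF L[OF that] C] by (simp add: mult_ac)
    qed (simp_all add: tadd tscale linear_add[OF P(1)] linear_scale[OF P(1)])
    show "(\<lambda>y. P (t y)) ` Y \<subseteq> G" using P(3) by auto
    fix y assume y: "y \<in> Y"
    show "norm (t y - P (t y)) \<le> (1 + C) * \<epsilon> * norm y"
    proof (cases "y = 0")
      case True
      then show ?thesis using L[OF y] linear_0[OF P(1)] by simp
    next
      case False
      define z where "z = (1 / norm y) *\<^sub>R y"
      have z: "z \<in> Y" "norm z \<le> 1" "y = norm y *\<^sub>R z"
        using y Y False by (auto simp: z_def subspace_scale)
      obtain a where a: "a \<in> A" "norm (t z - a) < \<epsilon>" using A(2) z by blast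
      have "t z - P (t z) = (t z - a) - P (t z - a)"
        using P(2)[of a] a(1) A(1) by (auto simp: linear_diff[OF P(1)])
      then have "norm (t z - P (t z)) \<le> norm (t z - a) + norm (P (t z - a))"
        by (metis norm_triangle_ineq4)
      also have "\<dots> \<le> norm (t z - a) + C * norm (t z - a)"
        using P(4)[of "t z - a"] by simp
      also have "\<dots> = (1 + C) * norm (t z - a)" by (simp add: distrib_right)
      also have "\<dots> \<le> (1 + C) * \<epsilon>" using a(2) C by (intro mult_left_mono) auto
      finally have "norm y * norm (t z - P (t z)) \<le> norm y * ((1 + C) * \<epsilon>)"
        by (intro mult_left_mono) auto
      moreover have "t y - P (t y) = norm y *\<^sub>R (t z - P (t z))"
        using tscale[OF z(1), of "norm y"] z(3)
        by (metis linear_scale[OF P(1)] scaleR_diff_right)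
      ultimately show ?thesis by (simp add: mult_ac)
    qed
  qed
qed

text \<open>
  If \<open>S\<^sub>n\<close> are finite-rank operators with \<open>S\<^sub>0 = 0\<close> that converge to \<open>t\<close> geometrically, then
  \<open>t = \<Sum> (S\<^sub>n\<^sub>+\<^sub>1 - S\<^sub>n)\<close>. The ranges of two consecutive operators lie in one
  \<open>C\<close>-injective subspace, so each difference extends with norm multiplied by at most \<open>C\<close>, and the
  extensions are summable because \<open>C\<close> does not depend on the subspace.
\<close>

lemma extension_of_uniform_limit_of_finite_rank:
  fixes t :: "'x::real_normed_vector \<Rightarrow> 'a::banach"
  assumes C: "0 \<le> C" and G: "\<And>B::'a set. finite B \<Longrightarrow>
      \<exists>G n. fin_dim_subspace G \<and> span B \<subseteq> G \<and> banach_mazur G (linf_dim n) < ereal C"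
    and Y: "subspace Y" and t: "bounded_linear_on Y t"
    and approx: "\<And>\<epsilon>. 0 < \<epsilon> \<Longrightarrow> \<exists>S F. bounded_linear_on Y S \<and> fin_dim_subspace F \<and> S ` Y \<subseteq> F \<and>
      (\<forall>y\<in>Y. norm (t y - S y) \<le> \<epsilon> * norm y)"
  obtains T where "bounded_linear T" "\<And>y. y \<in> Y \<Longrightarrow> T y = t y"
proof -
  obtain M where M: "1 \<le> M" "\<And>y. y \<in> Y \<Longrightarrow> norm (t y) \<le> M * norm y"
  proof -
    obtain L where L: "\<And>y. y \<in> Y \<Longrightarrow> norm (t y) \<le> norm y * L"
      using t unfolding bounded_linear_on_def by blast
    have "norm (t y) \<le> max 1 L * norm y" if "y \<in> Y" for y
      using L[OF that] mult_right_mono[of L "max 1 L" "norm y"] by (simp add: mult.commute)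
    then show ?thesis by (intro that[of "max 1 L"]) auto
  qed
  \<comment> \<open>As \<open>M\<close> bounds \<open>t\<close>, the zero operator is an admissible first approximation, and the series of
  differences then sums to \<open>t\<close> itself.\<close>
  have "\<forall>n. \<exists>S B. bounded_linear_on Y S \<and> finite B \<and> S ` Y \<subseteq> span B \<and>
      (\<forall>y\<in>Y. norm (t y - S y) \<le> M * (1/2) ^ n * norm y) \<and> (n = 0 \<longrightarrow> S = (\<lambda>_. 0))"
  proof
    fix n :: nat
    show "\<exists>S B. bounded_linear_on Y S \<and> finite B \<and> S ` Y \<subseteq> span B \<and>
      (\<forall>y\<in>Y. norm (t y - S y) \<le> M * (1/2) ^ n * norm y) \<and> (n = 0 \<longrightarrow> S = (\<lambda>_. 0))"
    proof (cases "n = 0")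
      case True
      then show ?thesis using M(2)
        by (intro exI[of _ "\<lambda>_. 0"] exI[of _ "{}"])
          (auto simp: bounded_linear_on_def intro!: exI[of _ 0])
    next
      case False
      have "0 < M * (1/2) ^ n" using M(1) by simp
      from approx[OF this] False show ?thesis unfolding fin_dim_subspace_def by blast
    qed
  qed
  then obtain S B where S: "\<And>n. bounded_linear_on Y (S n)"
    and B: "\<And>n. finite (B n)" "\<And>n. S n ` Y \<subseteq> span (B n)"
    and tS: "\<And>n y. y \<in> Y \<Longrightarrow> norm (t y - S n y) \<le> M * (1/2) ^ n * norm y"
    and S0: "S 0 = (\<lambda>_. 0)"
    by metis
  have "\<exists>U. linear U \<and> (\<forall>y\<in>Y. U y = S (Suc n) y - S n y) \<and>
      (\<forall>x. norm (U x) \<le> C * (2 * M * (1/2) ^ n) * norm x)" for n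
  proof -
    define D where "D y = S (Suc n) y - S n y" for y
    obtain H m where H: "span (B (Suc n) \<union> B n) \<subseteq> H" "banach_mazur H (linf_dim m) < ereal C"
      using G[of "B (Suc n) \<union> B n"] B(1) by auto
    have DK: "norm (D y) \<le> (2 * M * (1/2) ^ n) * norm y" if "y \<in> Y" for y
    proof -
      have "D y = (t y - S n y) - (t y - S (Suc n) y)" by (simp add: D_def)
      then have "norm (D y) \<le> norm (t y - S n y) + norm (t y - S (Suc n) y)"
        by (metis norm_triangle_ineq4)
      also have "\<dots> \<le> M * (1/2) ^ n * norm y + M * (1/2) ^ Suc n * norm y"
        using that by (intro add_mono tS)
      also have "\<dots> \<le> M * (1/2) ^ n * norm y + M * (1/2) ^ n * norm y"
        using M(1) by (intro add_left_mono mult_right_mono mult_left_mono) auto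
      finally show ?thesis by (simp add: mult_ac)
    qed
    have "bounded_linear_on Y D"
      unfolding bounded_linear_on_def
    proof (intro conjI ballI allI exI)
      show "D (x + y) = D x + D y" if "x \<in> Y" "y \<in> Y" for x y
        using S that by (simp add: bounded_linear_on_def D_def)
      show "D (r *\<^sub>R x) = r *\<^sub>R D x" if "x \<in> Y" for r x
        using S that by (simp add: bounded_linear_on_def D_def scaleR_diff_right)
      show "norm (D y) \<le> norm y * (2 * M * (1/2) ^ n)" if "y \<in> Y" for y
        using DK[OF that] by (simp add: mult_ac)
    qed
    moreover have "D y \<in> H" if "y \<in> Y" for y
    proof -
      have "S (Suc n) y \<in> span (B (Suc n) \<union> B n)" "S n y \<in> span (B (Suc n) \<union> B n)"
        using B(2) that span_mono[of "B (Suc n)" "B (Suc n) \<union> B n"]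
          span_mono[of "B n" "B (Suc n) \<union> B n"] by blast+
      then show ?thesis using H(1) by (auto simp: D_def span_diff)
    qed
    moreover have "0 \<le> 2 * M * (1/2) ^ n" using M(1) by simp
    ultimately obtain U where "linear U" "\<And>y. y \<in> Y \<Longrightarrow> U y = D y"
      "\<And>x. norm (U x) \<le> C * (2 * M * (1/2) ^ n) * norm x"
      using extension_into_near_linf_dim[OF H(2) Y _ _ DK] by metis
    then show ?thesis unfolding D_def by blast
  qed
  then obtain U where Ulin: "\<And>n. linear (U n)"
    and UY: "\<And>n y. y \<in> Y \<Longrightarrow> U n y = S (Suc n) y - S n y"
    and Ule: "\<And>n x. norm (U n x) \<le> C * (2 * M * (1/2) ^ n) * norm x"
    by metis
  define b where "b x n = (C * 2 * M * norm x) * (1/2) ^ n" for x :: 'x and n :: nat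
  have b: "b x sums (C * 4 * M * norm x)" for x
    using sums_mult[OF geometric_sums[of "1/2 :: real"], of "C * 2 * M * norm x"]
    by (simp add: b_def[abs_def] mult_ac)
  have Ub: "norm (U n x) \<le> b x n" for n x using Ule[of n x] by (simp add: b_def mult_ac)
  have summable: "summable (\<lambda>n. U n x)" for x
    using Ub by (intro summable_comparison_test'[OF sums_summable[OF b[of x]]]) auto
  define T where "T x = (\<Sum>n. U n x)" for x
  show ?thesis
  proof (rule that)
    show "bounded_linear T"
    proof (rule bounded_linear_intro)
      show "T (x + y) = T x + T y" for x y
        using suminf_add[OF summable summable] by (simp add: T_def linear_add[OF Ulin])
      show "T (r *\<^sub>R x) = r *\<^sub>R T x" for r x
        using suminf_scaleR_right[OF summable] by (simp add: T_def linear_scale[OF Ulin])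
      show "norm (T x) \<le> norm x * (C * 4 * M)" for x
        using norm_suminf_le[of "\<lambda>n. U n x" "b x"] Ub sums_summable[OF b[of x]] sums_unique[OF b[of x]]
        by (simp add: T_def mult_ac)
    qed
    fix y assume y: "y \<in> Y"
    have "(\<lambda>n. t y - S n y) \<longlonglongrightarrow> 0"
    proof (rule Lim_null_comparison[OF always_eventually])
      show "\<forall>n. norm (t y - S n y) \<le> M * (1/2) ^ n * norm y" using tS[OF y] by blast
      have "(\<lambda>n. M * (1/2) ^ n * norm y) \<longlonglongrightarrow> M * 0 * norm y"
        by (intro tendsto_intros LIMSEQ_realpow_zero) auto
      then show "(\<lambda>n. M * (1/2) ^ n * norm y) \<longlonglongrightarrow> 0" by simp
    qed
    then have "(\<lambda>n. t y - (t y - S n y)) \<longlonglongrightarrow> t y - 0" by (intro tendsto_diff tendsto_const)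
    then have "(\<lambda>n. S n y) \<longlonglongrightarrow> t y" by simp
    then have "(\<lambda>n. U n y) sums (t y - S 0 y)"
      using telescope_sums[of "\<lambda>n. S n y" "t y"] by (simp add: UY[OF y])
    then show "T y = t y" by (simp add: T_def S0 sums_iff)
  qed
qed

theorem proposition3p4:
  assumes "L_infinity_space TYPE('a::banach)"
    and "\<not> contains_c0 TYPE('a)"
  shows "LP_space TYPE('a)"
  unfolding LP_space_def
proof (intro allI impI, elim conjE)
  fix Y and t :: "linf \<Rightarrow> 'a"
  assume Y: "Y \<subseteq> c0" "subspace Y" and t: "bounded_linear_on Y t"
  obtain C where C: "0 \<le> C" and G: "\<And>B::'a set. finite B \<Longrightarrow>
      \<exists>G n. fin_dim_subspace G \<and> span B \<subseteq> G \<and> banach_mazur G (linf_dim n) < ereal C"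
    using L_infinity_spaceE[OF assms(1)] by blast
  have "\<exists>S F. bounded_linear_on Y S \<and> fin_dim_subspace F \<and> S ` Y \<subseteq> F \<and>
      (\<forall>y\<in>Y. norm (t y - S y) \<le> \<epsilon> * norm y)" if "0 < \<epsilon>" for \<epsilon>
  proof -
    define \<eta> where "\<eta> = \<epsilon> / (1 + C)"
    have \<eta>: "0 < \<eta>" "(1 + C) * \<eta> = \<epsilon>" using that C by (auto simp: \<eta>_def)
    obtain A where A: "finite A" "\<And>y. y \<in> Y \<Longrightarrow> norm y \<le> 1 \<Longrightarrow> \<exists>a\<in>A. norm (t y - a) < \<eta>"
      using totally_bounded_image_if_no_c0[OF assms(2) Y(2,1) t \<eta>(1)] by blast
    obtain F n where F: "fin_dim_subspace F" "span A \<subseteq> F" "banach_mazur F (linf_dim n) < ereal C"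
      using G[OF A(1)] by blast
    have "A \<subseteq> F" using F(2) span_superset by blast
    have "subspace F" using F(1) by (auto simp: fin_dim_subspace_def)
    from finite_rank_approximation[OF C this F(3) Y(2) t \<open>A \<subseteq> F\<close> A(2)]
    obtain S where "bounded_linear_on Y S" "S ` Y \<subseteq> F"
      "\<And>y. y \<in> Y \<Longrightarrow> norm (t y - S y) \<le> \<epsilon> * norm y"
      unfolding \<eta>(2) by blast
    with F(1) show ?thesis by blast
  qed
  then obtain T where T: "bounded_linear T" "\<And>y. y \<in> Y \<Longrightarrow> T y = t y"
    using extension_of_uniform_limit_of_finite_rank[OF C G Y(2) t] by blast
  have "bounded_linear_on c0 T"
    using T(1) by (auto simp: bounded_linear_on_UNIV[symmetric] bounded_linear_on_def)
  with T(2) show "\<exists>T. bounded_linear_on c0 T \<and> (\<forall>y\<in>Y. T y = t y)"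
    by blast
qed

end
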